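(* Let $R$ be a commutative semiring, $S$ a multiplicatively closed subset of $R$, $I'$ a proper ideal of $R$ disjoint from $S$, and $m\ge 1$ an integer. Let $\overline{S}=\{s+\langle x^m\rangle : s\in S\}\subseteq R[x]/\langle x^m\rangle$, and let $J=I'+Rx+Rx^2+\cdots+Rx^{m-1}+\langle x^m\rangle$, an ideal of $R[x]/\langle x^m\rangle$. Then $\overline{S}\cap J=\emptyset$, and $J$ is a quasi $\overline{S}$-$n$-ideal of $R[x]/\langle x^m\rangle$ if and only if $I'$ is a quasi $S$-$n$-ideal of $R$.
   Context: All semirings are commutative with identity $1\neq 0$. A subset $S$ of a semiring is multiplicatively closed if $0\notin S$, $1\in S$, and $st\in S$ for all $s,t\in S$. $N(R)$ denotes the nilradical (set of nilpotent elements) of $R$. A proper ideal $I$ of $R$ with $I\cap S=\emptyset$ is a quasi $S$-$n$-ideal of $R$ if there exists a fixed element $s\in S$ such that, for all $a,b\in R$, $ab\in I$ implies $sa^2\in I$ or $sb\in N(R)$. The quotient polynomial semiring $R[x]/\langle x^m\rangle$ is the quotient by the ideal $\langle x^m\rangle$ with partitioning set $Q(x)=\{a_0+a_1x+\cdots+a_{m-1}x^{m-1}: a_i\in R\}$: its elements are the cosets $q+\langle x^m\rangle$ with $q\in Q(x)$, which are pairwise disjoint for distinct $q$ and cover $R[x]$. The sum (resp. product) of $q_1+\langle x^m\rangle$ and $q_2+\langle x^m\rangle$ is $q+\langle x^m\rangle$, where $q\in Q(x)$ is the unique element with $q_1+q_2+\langle x^m\rangle\subseteq q+\langle x^m\rangle$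 (resp. $q_1q_2+\langle x^m\rangle\subseteq q+\langle x^m\rangle$); thus one adds or multiplies polynomials and discards terms of degree $\ge m$. The set $\overline{S}$ is multiplicatively closed in $R[x]/\langle x^m\rangle$. The notation $I'+Rx+\cdots+Rx^{m-1}+\langle x^m\rangle$ means the set of all $a_0+a_1x+\cdots+a_{m-1}x^{m-1}+\langle x^m\rangle$ with $a_0\in I'$ and $a_1,\dots,a_{m-1}\in R$. *)

theory Defs
  imports "HOL-Algebra.UnivPoly"
begin

text \<open>
  Commutative semirings are carrier-based, extending the locale \<open>semiring\<close> of HOL-Algebra.
  The polynomial semiring over \<open>R\<close> is \<open>UP R\<close>, whose definition does not use subtraction.  The
  library's \<open>ideal\<close> predicate presupposes a ring, so ideals of semirings are defined here.
\<close>

locale commutative_semiring = semiring R + comm_monoid R for R (structure) +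
  assumes one_neq_zero: "\<one> \<noteq> \<zero>"

definition semiring_ideal :: "('a, 'b) ring_scheme \<Rightarrow> 'a set \<Rightarrow> bool" where
  "semiring_ideal R I \<longleftrightarrow>
     I \<subseteq> carrier R \<and> I \<noteq> {} \<and>
     (\<forall>a\<in>I. \<forall>b\<in>I. a \<oplus>\<^bsub>R\<^esub> b \<in> I) \<and>
     (\<forall>r\<in>carrier R. \<forall>a\<in>I. r \<otimes>\<^bsub>R\<^esub> a \<in> I)"

definition proper_semiring_ideal :: "('a, 'b) ring_scheme \<Rightarrow> 'a set \<Rightarrow> bool" where
  "proper_semiring_ideal R I \<longleftrightarrow> semiring_ideal R I \<and> I \<noteq> carrier R"

definition mult_closed :: "('a, 'b) ring_scheme \<Rightarrow> 'a set \<Rightarrow> bool" where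
  "mult_closed R S \<longleftrightarrow>
     S \<subseteq> carrier R \<and> \<zero>\<^bsub>R\<^esub> \<notin> S \<and> \<one>\<^bsub>R\<^esub> \<in> S \<and>
     (\<forall>s\<in>S. \<forall>t\<in>S. s \<otimes>\<^bsub>R\<^esub> t \<in> S)"

definition nilradical :: "('a, 'b) ring_scheme \<Rightarrow> 'a set" where
  "nilradical R = {a \<in> carrier R. \<exists>n::nat. n \<ge> 1 \<and> a [^]\<^bsub>R\<^esub> n = \<zero>\<^bsub>R\<^esub>}"

definition quasi_n_ideal :: "('a, 'b) ring_scheme \<Rightarrow> 'a set \<Rightarrow> 'a set \<Rightarrow> bool" where
  "quasi_n_ideal R S I \<longleftrightarrow>
     proper_semiring_ideal R I \<and> I \<inter> S = {} \<and>
     (\<exists>s\<in>S. \<forall>a\<in>carrier R. \<forall>b\<in>carrier R.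
        a \<otimes>\<^bsub>R\<^esub> b \<in> I \<longrightarrow>
        s \<otimes>\<^bsub>R\<^esub> (a [^]\<^bsub>R\<^esub> (2::nat)) \<in> I \<or> s \<otimes>\<^bsub>R\<^esub> b \<in> nilradical R)"

text \<open>
  Quotient of a semiring \<open>P\<close> by an ideal \<open>I\<close> with partitioning set \<open>Q\<close>.  The descriptions below
  are meaningful only if the cosets \<open>q + I\<close> with \<open>q \<in> Q\<close> are pairwise disjoint and
  every coset \<open>p + I\<close> is contained in one of them.
\<close>

definition quot_rep :: "('a, 'b) ring_scheme \<Rightarrow> 'a set \<Rightarrow> 'a set \<Rightarrow> 'a set \<Rightarrow> 'a" where
  "quot_rep P I Q A = (THE q. q \<in> Q \<and> A = q <+\<^bsub>P\<^esub> I)"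

definition quot_reduce :: "('a, 'b) ring_scheme \<Rightarrow> 'a set \<Rightarrow> 'a set \<Rightarrow> 'a \<Rightarrow> 'a" where
  "quot_reduce P I Q p = (THE q. q \<in> Q \<and> p <+\<^bsub>P\<^esub> I \<subseteq> q <+\<^bsub>P\<^esub> I)"

definition quot_semiring :: "('a, 'b) ring_scheme \<Rightarrow> 'a set \<Rightarrow> 'a set \<Rightarrow> 'a set ring" where
  "quot_semiring P I Q = \<lparr>
     carrier = {q <+\<^bsub>P\<^esub> I | q. q \<in> Q},
     mult = (\<lambda>A B. quot_reduce P I Q (quot_rep P I Q A \<otimes>\<^bsub>P\<^esub> quot_rep P I Q B) <+\<^bsub>P\<^esub> I),
     one = quot_reduce P I Q \<one>\<^bsub>P\<^esub> <+\<^bsub>P\<^esub> I,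
     zero = quot_reduce P I Q \<zero>\<^bsub>P\<^esub> <+\<^bsub>P\<^esub> I,
     add = (\<lambda>A B. quot_reduce P I Q (quot_rep P I Q A \<oplus>\<^bsub>P\<^esub> quot_rep P I Q B) <+\<^bsub>P\<^esub> I)\<rparr>"

definition x_power_ideal :: "('a, 'b) ring_scheme \<Rightarrow> nat \<Rightarrow> (nat \<Rightarrow> 'a) set" where
  "x_power_ideal R m = PIdl\<^bsub>UP R\<^esub> (monom (UP R) \<one>\<^bsub>R\<^esub> m)"

definition poly_below :: "('a, 'b) ring_scheme \<Rightarrow> nat \<Rightarrow> (nat \<Rightarrow> 'a) \<Rightarrow> (nat \<Rightarrow> 'a)" where
  "poly_below R m a = (\<Oplus>\<^bsub>UP R\<^esub>i\<in>{..<m}. monom (UP R) (a i) i)"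

definition polys_below :: "('a, 'b) ring_scheme \<Rightarrow> nat \<Rightarrow> (nat \<Rightarrow> 'a) set" where
  "polys_below R m = {poly_below R m a | a. \<forall>i<m. a i \<in> carrier R}"

definition trunc_poly_semiring :: "('a, 'b) ring_scheme \<Rightarrow> nat \<Rightarrow> (nat \<Rightarrow> 'a) set ring" where
  "trunc_poly_semiring R m = quot_semiring (UP R) (x_power_ideal R m) (polys_below R m)"

definition const_cosets :: "('a, 'b) ring_scheme \<Rightarrow> nat \<Rightarrow> 'a set \<Rightarrow> (nat \<Rightarrow> 'a) set set" where
  "const_cosets R m S = {monom (UP R) s 0 <+\<^bsub>UP R\<^esub> x_power_ideal R m | s. s \<in> S}"

text \<open>The set \<open>I + R x + ... + R x^(m - 1) + \<langle>x^m\<rangle>\<close> of cosets\<close>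

definition const_term_ideal :: "('a, 'b) ring_scheme \<Rightarrow> nat \<Rightarrow> 'a set \<Rightarrow> (nat \<Rightarrow> 'a) set set" where
  "const_term_ideal R m I =
     {poly_below R m a <+\<^bsub>UP R\<^esub> x_power_ideal R m | a.
        a 0 \<in> I \<and> (\<forall>i\<in>{1..<m}. a i \<in> carrier R)}"

end

theory Submission
  imports Defs
begin

text \<open>
  Taking constant terms is a surjective semiring homomorphism \<open>h\<close> from \<open>R[x]/\<langle>x^m\<rangle>\<close> onto \<open>R\<close>.
  The set \<open>J\<close> is the preimage of \<open>I'\<close> under \<open>h\<close> (\<open>const_term_ideal_eq\<close>), and \<open>h\<close> maps the set of
  constant cosets onto \<open>S\<close> (\<open>const_term_const_cosets\<close>).  This makes \<open>J\<close> an ideal disjoint from the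
  constant cosets.

  Moreover, a coset is nilpotent if and only if its constant term is (\<open>nilradical_trunc_iff\<close>).  The
  conditions \<open>a b \<in> J\<close>, \<open>s a\<^sup>2 \<in> J\<close> and \<open>s b \<in> N(R[x]/\<langle>x^m\<rangle>)\<close> therefore only depend on the constant
  terms of \<open>s\<close>, \<open>a\<close> and \<open>b\<close>, and they are the corresponding conditions for \<open>I'\<close> in \<open>R\<close>.  Since \<open>h\<close> is
  surjective, a constant coset witnesses the property for \<open>J\<close> exactly if its constant term
  witnesses it for \<open>I'\<close> (\<open>quasi_n_ideal_preimage_iff\<close>).

  The nontrivial half of the statement on nilpotents says that \<open>p = c + a\<^sub>1 x + \<dots>\<close> is nilpotent modulo
  \<open>x^m\<close> if \<open>c\<close> is nilpotent.  A product of \<open>n\<close> coefficients of \<open>p\<close> that contributes to the coefficient of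
  \<open>x^i\<close> in \<open>p^n\<close> has at most \<open>i\<close> factors other than \<open>c\<close>, so this coefficient is a multiple of
  \<open>c^(n - i)\<close> (\<open>trunc_pow_coeffs\<close>).  If \<open>c^k = 0\<close>, then all coefficients of \<open>p^(k + m)\<close> below \<open>x^m\<close>
  vanish.

  For computing in the quotient, the coset of \<open>q\<close>, where \<open>q\<close> has degree less than \<open>m\<close>, is
  recognised as the set of all polynomials with the same first \<open>m\<close> coefficients as \<open>q\<close>.  Every polynomial
  \<open>p\<close> determines such a set, \<open>trunc_class m p\<close>, and \<open>p \<mapsto> trunc_class m p\<close> is compatible with the
  operations of \<open>R[x]\<close>.
\<close>

section \<open>Preimages of quasi n-ideals\<close>

text \<open>
  The homomorphism predicate of the library only constrains the operations on the carriers,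
  so it makes sense between semirings.  The closure assumptions keep products and powers formed in
  the domain inside the set on which \<open>h\<close> is a homomorphism.
\<close>

locale surj_semiring_hom =
  fixes T (structure) and R (structure) and h
  assumes add_closed: "\<And>x y. \<lbrakk>x \<in> carrier T; y \<in> carrier T\<rbrakk> \<Longrightarrow> x \<oplus>\<^bsub>T\<^esub> y \<in> carrier T"
    and mult_closed: "\<And>x y. \<lbrakk>x \<in> carrier T; y \<in> carrier T\<rbrakk> \<Longrightarrow> x \<otimes>\<^bsub>T\<^esub> y \<in> carrier T"
    and one_closed: "\<one>\<^bsub>T\<^esub> \<in> carrier T"
    and hom: "h \<in> ring_hom T R"
    and surj: "h ` carrier T = carrier R"
begin

lemma pow_closed: "x \<in> carrier T \<Longrightarrow> x [^]\<^bsub>T\<^esub> (n::nat) \<in> carrier T"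
  by (induction n) (simp_all add: nat_pow_def one_closed mult_closed)

lemma hom_closed: "x \<in> carrier T \<Longrightarrow> h x \<in> carrier R"
  using surj by blast

lemmas hom_simps = ring_hom_mult[OF hom] ring_hom_add[OF hom] ring_hom_one[OF hom]

lemma hom_pow: "x \<in> carrier T \<Longrightarrow> h (x [^]\<^bsub>T\<^esub> (n::nat)) = h x [^]\<^bsub>R\<^esub> n"
proof (induction n)
  case (Suc n)
  have "h (x [^]\<^bsub>T\<^esub> n \<otimes>\<^bsub>T\<^esub> x) = h x [^]\<^bsub>R\<^esub> n \<otimes>\<^bsub>R\<^esub> h x"
    using Suc pow_closed by (simp add: hom_simps)
  then show ?case
    by (simp add: nat_pow_def)
qed (simp add: nat_pow_def hom_simps)

definition preimage :: "'c set \<Rightarrow> 'a set" where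
  "preimage I = {x \<in> carrier T. h x \<in> I}"

lemma preimage_semiring_ideal:
  assumes "semiring_ideal R I"
  shows "semiring_ideal T (preimage I)"
proof -
  from assms obtain a where "a \<in> I" "a \<in> carrier R"
    by (auto simp: semiring_ideal_def)
  then have "preimage I \<noteq> {}"
    using surj by (auto simp: preimage_def) (metis imageE)
  then show ?thesis
    using assms unfolding semiring_ideal_def
    by (auto simp: preimage_def add_closed mult_closed hom_simps hom_closed)
qed

lemma preimage_proper_semiring_ideal:
  assumes "proper_semiring_ideal R I"
  shows "proper_semiring_ideal T (preimage I)"
proof -
  obtain a where "a \<in> carrier R" "a \<notin> I"
    using assms by (auto simp: proper_semiring_ideal_def semiring_ideal_def)
  then obtain x where "x \<in> carrier T" "h x \<notin> I"
    using surj by (metis imageE)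
  then have "preimage I \<noteq> carrier T"
    by (auto simp: preimage_def)
  then show ?thesis
    using assms preimage_semiring_ideal by (simp add: proper_semiring_ideal_def)
qed

lemma preimage_disjoint:
  assumes "h ` S' = S" "I \<inter> S = {}"
  shows "preimage I \<inter> S' = {}"
  using assms by (auto simp: preimage_def)

text \<open>
  Every condition in the definition of a quasi n-ideal can be read off after applying \<open>h\<close>:
  membership in the preimage by definition, membership in the nilradical by the assumption \<open>nil\<close>.
  Surjectivity lets quantifiers over \<open>carrier T\<close> and \<open>S'\<close> be replaced by quantifiers over
  \<open>carrier R\<close> and \<open>S\<close>.
\<close>

theorem quasi_n_ideal_preimage_iff:
  assumes nil: "\<And>x. x \<in> carrier T \<Longrightarrow> h x \<in> nilradical R \<longleftrightarrow> x \<in> nilradical T"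
    and S': "S' \<subseteq> carrier T" "h ` S' = S"
    and I: "proper_semiring_ideal R I" "I \<inter> S = {}"
  shows "quasi_n_ideal T S' (preimage I) \<longleftrightarrow> quasi_n_ideal R S I"
proof -
  let ?Q = "\<lambda>s. \<forall>a\<in>carrier R. \<forall>b\<in>carrier R. a \<otimes>\<^bsub>R\<^esub> b \<in> I \<longrightarrow>
    s \<otimes>\<^bsub>R\<^esub> (a [^]\<^bsub>R\<^esub> (2::nat)) \<in> I \<or> s \<otimes>\<^bsub>R\<^esub> b \<in> nilradical R"
  let ?Q' = "\<lambda>s. \<forall>a\<in>carrier T. \<forall>b\<in>carrier T. a \<otimes>\<^bsub>T\<^esub> b \<in> preimage I \<longrightarrow>
    s \<otimes>\<^bsub>T\<^esub> (a [^]\<^bsub>T\<^esub> (2::nat)) \<in> preimage I \<or> s \<otimes>\<^bsub>T\<^esub> b \<in> nilradical T"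
  have Q_iff: "?Q' s \<longleftrightarrow> ?Q (h s)" if s: "s \<in> S'" for s
  proof -
    have sT: "s \<in> carrier T"
      using s S' by blast
    have "?Q' s \<longleftrightarrow> (\<forall>a\<in>carrier T. \<forall>b\<in>carrier T. h a \<otimes>\<^bsub>R\<^esub> h b \<in> I \<longrightarrow>
      h s \<otimes>\<^bsub>R\<^esub> (h a [^]\<^bsub>R\<^esub> (2::nat)) \<in> I \<or> h s \<otimes>\<^bsub>R\<^esub> h b \<in> nilradical R)"
      using sT
      by (simp add: preimage_def mult_closed pow_closed hom_simps hom_pow flip: nil)
    also have "\<dots> \<longleftrightarrow> ?Q (h s)"
      unfolding surj[symmetric] by simp
    finally show ?thesis .
  qed
  have "(\<exists>s\<in>S'. ?Q' s) \<longleftrightarrow> (\<exists>s\<in>S. ?Q s)"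
    using Q_iff unfolding S'(2)[symmetric] by simp
  then show ?thesis
    using I preimage_proper_semiring_ideal[OF I(1)] preimage_disjoint[OF S'(2) I(2)]
    by (simp add: quasi_n_ideal_def)
qed

end


section \<open>Polynomials over a commutative semiring\<close>

context commutative_semiring
begin

text \<open>
  As over a ring, polynomials are finitely supported functions.  The arguments about their operations
  carry over because none of them involves negation.
\<close>

lemma up_add_closed:
  assumes p: "p \<in> up R" and q: "q \<in> up R"
  shows "(\<lambda>i. p i \<oplus> q i) \<in> up R"
proof
  from p q obtain k l where "bound \<zero> k p" "bound \<zero> l q"
    unfolding up_def by blast
  then have "bound \<zero> (max k l) (\<lambda>i. p i \<oplus> q i)"
    by (auto simp: bound_def)
  then show "\<exists>n. bound \<zero> n (\<lambda>i. p i \<oplus> q i)" ..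
qed (use p q in \<open>simp add: mem_upD\<close>)

lemma convolution_closed:
  assumes "p \<in> up R" "q \<in> up R"
  shows "(\<Oplus>i\<in>{..n}. p i \<otimes> q (n - i)) \<in> carrier R"
  using assms by (intro finsum_closed) (auto simp: mem_upD)

lemma up_mult_closed:
  assumes p: "p \<in> up R" and q: "q \<in> up R"
  shows "(\<lambda>n. \<Oplus>i\<in>{..n}. p i \<otimes> q (n - i)) \<in> up R"
proof
  from p q obtain k l where k: "bound \<zero> k p" and l: "bound \<zero> l q"
    unfolding up_def by blast
  have "(\<Oplus>i\<in>{..n}. p i \<otimes> q (n - i)) = \<zero>" if "k + l < n" for n
  proof (rule add.finprod_one_eqI)
    fix i
    have "k < i \<or> l < n - i"
      using that by arith
    then show "p i \<otimes> q (n - i) = \<zero>"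
      using k l p q by (auto simp: bound_def mem_upD)
  qed
  then have "bound \<zero> (k + l) (\<lambda>n. \<Oplus>i\<in>{..n}. p i \<otimes> q (n - i))"
    by (simp add: bound_def)
  then show "\<exists>b. bound \<zero> b (\<lambda>n. \<Oplus>i\<in>{..n}. p i \<otimes> q (n - i))" ..
qed (rule convolution_closed[OF p q])

lemma up_finite_support:
  assumes "\<And>i. i < k \<Longrightarrow> f i \<in> carrier R"
  shows "(\<lambda>i. if i < k then f i else \<zero>) \<in> up R"
proof
  have "bound \<zero> k (\<lambda>i. if i < k then f i else \<zero>)"
    by (simp add: bound_def)
  then show "\<exists>n. bound \<zero> n (\<lambda>i. if i < k then f i else \<zero>)" ..
qed (use assms in simp)

lemma up_monom: "a \<in> carrier R \<Longrightarrow> (\<lambda>i. if i = k then a else \<zero>) \<in> up R"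
  by (auto intro!: exI[of _ k] simp: bound_def)

lemma up_shift:
  assumes "p \<in> up R"
  shows "(\<lambda>i. p (i + k)) \<in> up R"
proof
  from assms obtain b where "bound \<zero> b p"
    unfolding up_def by blast
  then have "bound \<zero> b (\<lambda>i. p (i + k))"
    by (simp add: bound_def)
  then show "\<exists>n. bound \<zero> n (\<lambda>i. p (i + k))" ..
qed (use assms in \<open>simp add: mem_upD\<close>)

lemma UP_carrier: "carrier (UP R) = up R"
  by (simp add: UP_def)

lemma UP_add: "\<lbrakk>p \<in> up R; q \<in> up R\<rbrakk> \<Longrightarrow> p \<oplus>\<^bsub>UP R\<^esub> q = (\<lambda>i. p i \<oplus> q i)"
  by (simp add: UP_def)

lemma UP_mult: "\<lbrakk>p \<in> up R; q \<in> up R\<rbrakk> \<Longrightarrow>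
    p \<otimes>\<^bsub>UP R\<^esub> q = (\<lambda>n. \<Oplus>i\<in>{..n}. p i \<otimes> q (n - i))"
  by (simp add: UP_def)

lemma UP_one: "\<one>\<^bsub>UP R\<^esub> = (\<lambda>i. if i = 0 then \<one> else \<zero>)"
  by (simp add: UP_def)

lemma UP_zero: "\<zero>\<^bsub>UP R\<^esub> = (\<lambda>i. \<zero>)"
  by (simp add: UP_def)

lemma UP_monom: "a \<in> carrier R \<Longrightarrow> monom (UP R) a k = (\<lambda>i. if i = k then a else \<zero>)"
  by (simp add: UP_def)

lemma UP_zero_closed: "\<zero>\<^bsub>UP R\<^esub> \<in> up R"
  unfolding UP_zero by (auto simp: bound_def)

lemma UP_one_closed: "\<one>\<^bsub>UP R\<^esub> \<in> up R"
  unfolding UP_one by (simp add: up_monom)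

lemma UP_add_closed: "\<lbrakk>p \<in> up R; q \<in> up R\<rbrakk> \<Longrightarrow> p \<oplus>\<^bsub>UP R\<^esub> q \<in> up R"
  by (simp add: UP_add up_add_closed)

lemma UP_mult_closed: "\<lbrakk>p \<in> up R; q \<in> up R\<rbrakk> \<Longrightarrow> p \<otimes>\<^bsub>UP R\<^esub> q \<in> up R"
  by (simp add: UP_mult up_mult_closed)

lemma UP_abelian_monoid: "abelian_monoid (UP R)"
proof (rule abelian_monoidI; (unfold UP_carrier)?)
  fix p q r
  assume *: "p \<in> up R" "q \<in> up R" "r \<in> up R"
  then show "p \<oplus>\<^bsub>UP R\<^esub> q \<oplus>\<^bsub>UP R\<^esub> r = p \<oplus>\<^bsub>UP R\<^esub> (q \<oplus>\<^bsub>UP R\<^esub> r)"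
    by (simp add: UP_add up_add_closed a_assoc mem_upD)
next
  fix p q
  assume "p \<in> up R" "q \<in> up R"
  then show "p \<oplus>\<^bsub>UP R\<^esub> q = q \<oplus>\<^bsub>UP R\<^esub> p"
    by (simp add: UP_add a_comm mem_upD)
next
  fix p
  assume "p \<in> up R"
  then show "\<zero>\<^bsub>UP R\<^esub> \<oplus>\<^bsub>UP R\<^esub> p = p"
    using UP_zero_closed by (simp add: UP_add mem_upD) (simp add: UP_zero mem_upD)
qed (simp_all add: UP_add_closed UP_zero_closed)

text \<open>
  The sum \<open>poly_below R m a\<close> is formed in \<open>UP R\<close>, which is why the additive monoid laws of \<open>UP R\<close>
  are required.
\<close>

lemma poly_below_eq:
  assumes "\<And>i. i < m \<Longrightarrow> a i \<in> carrier R"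
  shows "poly_below R m a = (\<lambda>i. if i < m then a i else \<zero>)"
  using assms
proof (induction m)
  interpret U: abelian_monoid "UP R"
    by (rule UP_abelian_monoid)
  {
    case 0
    show ?case
      by (simp add: poly_below_def UP_zero)
  next
    case (Suc m)
    let ?p = "\<lambda>i. if i < m then a i else \<zero>"
    have monom: "monom (UP R) (a i) i \<in> up R" if "i \<le> m" for i
      using Suc.prems[of i] that by (simp add: UP_monom up_monom)
    have "poly_below R (Suc m) a = monom (UP R) (a m) m \<oplus>\<^bsub>UP R\<^esub> poly_below R m a"
      unfolding poly_below_def lessThan_Suc
      by (rule U.finsum_insert) (auto simp: UP_carrier monom)
    also have "\<dots> = monom (UP R) (a m) m \<oplus>\<^bsub>UP R\<^esub> ?p"
      using Suc by simp
    also have "\<dots> = (\<lambda>i. if i < Suc m then a i else \<zero>)"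
      using Suc.prems monom[of m]
      by (auto simp: UP_add up_finite_support UP_monom less_Suc_eq fun_eq_iff)
    finally show ?case .
  }
qed

lemma poly_below_closed: "(\<And>i. i < m \<Longrightarrow> a i \<in> carrier R) \<Longrightarrow> poly_below R m a \<in> up R"
  by (simp add: poly_below_eq up_finite_support)

lemma polys_below_eq: "polys_below R m = {p \<in> up R. \<forall>i\<ge>m. p i = \<zero>}"
proof (intro equalityI subsetI)
  fix p
  assume p: "p \<in> {p \<in> up R. \<forall>i\<ge>m. p i = \<zero>}"
  then have "p = poly_below R m p"
    by (auto simp: poly_below_eq mem_upD fun_eq_iff)
  then show "p \<in> polys_below R m"
    using p unfolding polys_below_def by blast
qed (auto simp: polys_below_def poly_below_eq up_finite_support)

lemma mult_x_power:
  assumes p: "p \<in> up R"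
  shows "p \<otimes>\<^bsub>UP R\<^esub> monom (UP R) \<one> m = (\<lambda>n. if n < m then \<zero> else p (n - m))"
proof
  fix n
  have "(p \<otimes>\<^bsub>UP R\<^esub> monom (UP R) \<one> m) n = (\<Oplus>i\<in>{..n}. p i \<otimes> (if n - i = m then \<one> else \<zero>))"
    using p by (simp add: UP_mult UP_monom up_monom)
  also have "\<dots> = (if n < m then \<zero> else p (n - m))"
  proof (cases "n < m")
    case True
    then have "(\<Oplus>i\<in>{..n}. p i \<otimes> (if n - i = m then \<one> else \<zero>)) = \<zero>"
      using p by (intro add.finprod_one_eqI) (auto simp: mem_upD)
    with True show ?thesis
      by simp
  next
    case False
    have "(\<Oplus>i\<in>{..n}. p i \<otimes> (if n - i = m then \<one> else \<zero>))
        = (\<Oplus>i\<in>{..n}. if n - m = i then p i else \<zero>)"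
      using False p by (intro finsum_cong') (auto simp: mem_upD)
    also have "\<dots> = p (n - m)"
      using p by (intro finsum_singleton) (auto simp: mem_upD)
    finally show ?thesis
      using False by simp
  qed
  finally show "(p \<otimes>\<^bsub>UP R\<^esub> monom (UP R) \<one> m) n = (if n < m then \<zero> else p (n - m))" .
qed

lemma x_power_ideal_eq: "x_power_ideal R m = {p \<in> up R. \<forall>i<m. p i = \<zero>}"
proof (intro equalityI subsetI)
  fix p
  assume "p \<in> x_power_ideal R m"
  then obtain q where q: "q \<in> up R" "p = q \<otimes>\<^bsub>UP R\<^esub> monom (UP R) \<one> m"
    by (auto simp: x_power_ideal_def cgenideal_def UP_carrier)
  then have "p \<in> up R"
    by (simp add: UP_mult_closed UP_monom up_monom)
  then show "p \<in> {p \<in> up R. \<forall>i<m. p i = \<zero>}"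
    using q by (simp add: mult_x_power)
next
  fix p
  assume p: "p \<in> {p \<in> up R. \<forall>i<m. p i = \<zero>}"
  then have shift: "(\<lambda>i. p (i + m)) \<in> up R"
    by (simp add: up_shift)
  have "p = (\<lambda>i. p (i + m)) \<otimes>\<^bsub>UP R\<^esub> monom (UP R) \<one> m"
    using p by (auto simp: mult_x_power[OF shift])
  then show "p \<in> x_power_ideal R m"
    using shift unfolding x_power_ideal_def cgenideal_def UP_carrier by blast
qed


section \<open>Cosets of the ideal generated by a power of x\<close>

text \<open>
  For \<open>q\<close> of degree less than \<open>m\<close> this is the coset \<open>q + \<langle>x^m\<rangle>\<close>.  For general \<open>p\<close> it is the unique
  coset of the partition that contains \<open>p + \<langle>x^m\<rangle>\<close>; the inclusion can be strict, because
  the coefficients of \<open>p\<close> from degree \<open>m\<close> on cannot be subtracted in a semiring.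
\<close>

definition trunc_class :: "nat \<Rightarrow> (nat \<Rightarrow> 'a) \<Rightarrow> (nat \<Rightarrow> 'a) set" where
  "trunc_class m p = {r \<in> up R. \<forall>i<m. r i = p i}"

lemma trunc_class_eq_iff:
  assumes "p \<in> up R"
  shows "trunc_class m p = trunc_class m q \<longleftrightarrow> (\<forall>i<m. p i = q i)"
  using assms by (auto simp: trunc_class_def)

lemma coset_x_power:
  "q <+\<^bsub>UP R\<^esub> x_power_ideal R m = {q \<oplus>\<^bsub>UP R\<^esub> r | r. r \<in> up R \<and> (\<forall>i<m. r i = \<zero>)}"
  by (auto simp: a_l_coset_def' x_power_ideal_eq)

lemma coset_subset_trunc_class:
  assumes "p \<in> up R"
  shows "p <+\<^bsub>UP R\<^esub> x_power_ideal R m \<subseteq> trunc_class m p"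
  using assms
  by (auto simp: coset_x_power trunc_class_def UP_add up_add_closed mem_upD)

lemma coset_eq_trunc_class:
  assumes q: "q \<in> polys_below R m"
  shows "q <+\<^bsub>UP R\<^esub> x_power_ideal R m = trunc_class m q"
proof
  have q': "q \<in> up R" "\<And>i. i \<ge> m \<Longrightarrow> q i = \<zero>"
    using q by (auto simp: polys_below_eq)
  show "q <+\<^bsub>UP R\<^esub> x_power_ideal R m \<subseteq> trunc_class m q"
    by (rule coset_subset_trunc_class[OF q'(1)])
  show "trunc_class m q \<subseteq> q <+\<^bsub>UP R\<^esub> x_power_ideal R m"
  proof
    fix p
    assume p: "p \<in> trunc_class m q"
    \<comment> \<open>Here subtraction is avoidable: \<open>q\<close> vanishes from degree \<open>m\<close> on, so \<open>p - q\<close> is the tail of \<open>p\<close>.\<close>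
    let ?r = "\<lambda>i. if i < m then \<zero> else p i"
    from p obtain b where "bound \<zero> b p"
      unfolding trunc_class_def up_def by blast
    then have "bound \<zero> b ?r"
      by (simp add: bound_def)
    then have r: "?r \<in> up R"
      using p by (intro mem_upI exI[of _ b]) (auto simp: trunc_class_def mem_upD)
    moreover have "p = q \<oplus>\<^bsub>UP R\<^esub> ?r"
      using p q' r by (auto simp: UP_add trunc_class_def fun_eq_iff mem_upD)
    ultimately show "p \<in> q <+\<^bsub>UP R\<^esub> x_power_ideal R m"
      unfolding coset_x_power by (intro CollectI exI[of _ ?r]) simp
  qed
qed

lemma polys_below_eqI:
  assumes "p \<in> polys_below R m" "q \<in> polys_below R m" "\<And>i. i < m \<Longrightarrow> p i = q i"
  shows "p = q"
  using assms by (intro ext) (metis (mono_tags, lifting) polys_below_eq mem_Collect_eq linorder_not_less)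

lemma poly_below_in_polys_below: "p \<in> up R \<Longrightarrow> poly_below R m p \<in> polys_below R m"
  by (auto simp: polys_below_def mem_upD)

lemma coset_poly_below:
  assumes "\<And>i. i < m \<Longrightarrow> a i \<in> carrier R"
  shows "poly_below R m a <+\<^bsub>UP R\<^esub> x_power_ideal R m = trunc_class m a"
proof -
  have "poly_below R m a \<in> polys_below R m"
    using assms by (auto simp: polys_below_def)
  then have "poly_below R m a <+\<^bsub>UP R\<^esub> x_power_ideal R m = trunc_class m (poly_below R m a)"
    by (rule coset_eq_trunc_class)
  also have "\<dots> = trunc_class m a"
    using assms by (auto simp: trunc_class_def poly_below_eq)
  finally show ?thesis .
qed

lemma quot_reduce_eq:
  assumes p: "p \<in> up R"
  shows "quot_reduce (UP R) (x_power_ideal R m) (polys_below R m) p = poly_below R m p"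
  unfolding quot_reduce_def
proof (rule the_equality)
  show "poly_below R m p \<in> polys_below R m \<and>
      p <+\<^bsub>UP R\<^esub> x_power_ideal R m \<subseteq> poly_below R m p <+\<^bsub>UP R\<^esub> x_power_ideal R m"
    using p coset_subset_trunc_class[OF p]
    by (simp add: poly_below_in_polys_below coset_poly_below mem_upD)
next
  fix q
  assume "q \<in> polys_below R m \<and>
      p <+\<^bsub>UP R\<^esub> x_power_ideal R m \<subseteq> q <+\<^bsub>UP R\<^esub> x_power_ideal R m"
  then have q: "q \<in> polys_below R m" "p <+\<^bsub>UP R\<^esub> x_power_ideal R m \<subseteq> trunc_class m q"
    by (auto simp: coset_eq_trunc_class)
  have "p \<oplus>\<^bsub>UP R\<^esub> \<zero>\<^bsub>UP R\<^esub> \<in> p <+\<^bsub>UP R\<^esub> x_power_ideal R m"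
    unfolding coset_x_power using UP_zero_closed by (auto simp: UP_zero)
  moreover have "p \<oplus>\<^bsub>UP R\<^esub> \<zero>\<^bsub>UP R\<^esub> = p"
    using p UP_zero_closed by (simp add: UP_add) (simp add: UP_zero mem_upD)
  ultimately have "p \<in> trunc_class m q"
    using q by auto
  then show "q = poly_below R m p"
    using p q(1)
    by (intro polys_below_eqI[of _ m]) (auto simp: poly_below_in_polys_below poly_below_eq mem_upD trunc_class_def)
qed

lemma quot_rep_eq:
  assumes p: "p \<in> up R"
  shows "quot_rep (UP R) (x_power_ideal R m) (polys_below R m) (trunc_class m p) = poly_below R m p"
  unfolding quot_rep_def
proof (rule the_equality)
  show "poly_below R m p \<in> polys_below R m \<and>
      trunc_class m p = poly_below R m p <+\<^bsub>UP R\<^esub> x_power_ideal R m"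
    using p by (simp add: poly_below_in_polys_below coset_poly_below mem_upD)
next
  fix q
  assume "q \<in> polys_below R m \<and> trunc_class m p = q <+\<^bsub>UP R\<^esub> x_power_ideal R m"
  then have q: "q \<in> polys_below R m" "trunc_class m p = trunc_class m q"
    by (auto simp: coset_eq_trunc_class)
  then show "q = poly_below R m p"
    using p by (intro polys_below_eqI[of _ m])
      (auto simp: poly_below_in_polys_below poly_below_eq mem_upD trunc_class_eq_iff)
qed


section \<open>The truncated polynomial semiring\<close>

text \<open>
  In view of the next lemmas, \<open>trunc_class m\<close> is the projection of \<open>R[x]\<close> onto the quotient.
  Computations in the quotient can thus be done with arbitrary polynomials instead of reduced ones.
\<close>

lemma trunc_carrier: "carrier (trunc_poly_semiring R m) = trunc_class m ` up R"
proof -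
  have "polys_below R m \<subseteq> up R"
    by (auto simp: polys_below_eq)
  moreover have "trunc_class m p \<in> {q <+\<^bsub>UP R\<^esub> x_power_ideal R m | q. q \<in> polys_below R m}"
    if "p \<in> up R" for p
    using that coset_poly_below[of m p] poly_below_in_polys_below[of p m]
    by (auto simp: mem_upD intro!: exI[of _ "poly_below R m p"])
  ultimately show ?thesis
    by (auto simp: trunc_poly_semiring_def quot_semiring_def coset_eq_trunc_class)
qed

lemma trunc_class_reduce:
  assumes "p \<in> up R"
  shows "quot_reduce (UP R) (x_power_ideal R m) (polys_below R m) p <+\<^bsub>UP R\<^esub> x_power_ideal R m
    = trunc_class m p"
  using assms by (simp add: quot_reduce_eq coset_poly_below mem_upD)

lemma trunc_one: "\<one>\<^bsub>trunc_poly_semiring R m\<^esub> = trunc_class m \<one>\<^bsub>UP R\<^esub>"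
  by (simp add: trunc_poly_semiring_def quot_semiring_def trunc_class_reduce UP_one_closed)

lemma trunc_zero: "\<zero>\<^bsub>trunc_poly_semiring R m\<^esub> = trunc_class m \<zero>\<^bsub>UP R\<^esub>"
  by (simp add: trunc_poly_semiring_def quot_semiring_def trunc_class_reduce UP_zero_closed)

lemma trunc_add:
  assumes "p \<in> up R" "q \<in> up R"
  shows "trunc_class m p \<oplus>\<^bsub>trunc_poly_semiring R m\<^esub> trunc_class m q
    = trunc_class m (p \<oplus>\<^bsub>UP R\<^esub> q)"
proof -
  have pq: "poly_below R m p \<in> up R" "poly_below R m q \<in> up R"
    using assms by (auto intro: poly_below_closed simp: mem_upD)
  have "trunc_class m p \<oplus>\<^bsub>trunc_poly_semiring R m\<^esub> trunc_class m q
    = trunc_class m (poly_below R m p \<oplus>\<^bsub>UP R\<^esub> poly_below R m q)"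
    using assms pq
    by (simp add: trunc_poly_semiring_def quot_semiring_def quot_rep_eq trunc_class_reduce UP_add_closed)
  also have "\<dots> = trunc_class m (p \<oplus>\<^bsub>UP R\<^esub> q)"
    using assms pq
    by (simp add: trunc_class_eq_iff UP_add_closed) (simp add: UP_add poly_below_eq mem_upD)
  finally show ?thesis .
qed

lemma trunc_mult:
  assumes "p \<in> up R" "q \<in> up R"
  shows "trunc_class m p \<otimes>\<^bsub>trunc_poly_semiring R m\<^esub> trunc_class m q
    = trunc_class m (p \<otimes>\<^bsub>UP R\<^esub> q)"
proof -
  have pq: "poly_below R m p \<in> up R" "poly_below R m q \<in> up R"
    using assms by (auto intro: poly_below_closed simp: mem_upD)
  have "trunc_class m p \<otimes>\<^bsub>trunc_poly_semiring R m\<^esub> trunc_class m q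
    = trunc_class m (poly_below R m p \<otimes>\<^bsub>UP R\<^esub> poly_below R m q)"
    using assms pq
    by (simp add: trunc_poly_semiring_def quot_semiring_def quot_rep_eq trunc_class_reduce UP_mult_closed)
  also have "\<dots> = trunc_class m (p \<otimes>\<^bsub>UP R\<^esub> q)"
  proof -
    \<comment> \<open>A coefficient of degree below \<open>m\<close> of a product involves only such coefficients of the factors.\<close>
    have "(\<Oplus>i\<in>{..n}. poly_below R m p i \<otimes> poly_below R m q (n - i))
        = (\<Oplus>i\<in>{..n}. p i \<otimes> q (n - i))" if "n < m" for n
      using assms that by (intro finsum_cong') (auto simp: poly_below_eq mem_upD)
    then show ?thesis
      using assms pq by (simp add: trunc_class_eq_iff UP_mult_closed) (simp add: UP_mult)
  qed
  finally show ?thesis .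
qed

text \<open>
  The choice of a representative does not matter for \<open>m \<ge> 1\<close>, since all members of a coset then
  have the same constant term.
\<close>

definition const_term :: "(nat \<Rightarrow> 'a) set \<Rightarrow> 'a" where
  "const_term A = (SOME p. p \<in> A) 0"

lemma const_term_trunc_class:
  assumes p: "p \<in> up R" and m: "m \<ge> 1"
  shows "const_term (trunc_class m p) = p 0"
proof -
  have "p \<in> trunc_class m p"
    using p by (simp add: trunc_class_def)
  then have "(SOME r. r \<in> trunc_class m p) \<in> trunc_class m p"
    by (rule someI[where P = "\<lambda>r. r \<in> trunc_class m p"])
  then show ?thesis
    using m by (simp add: const_term_def trunc_class_def)
qed

lemma const_term_surj_hom:
  assumes m: "m \<ge> 1"
  shows "surj_semiring_hom (trunc_poly_semiring R m) R const_term"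
proof
  show "const_term \<in> ring_hom (trunc_poly_semiring R m) R"
  proof (rule ring_hom_memI)
    fix A B
    assume "A \<in> carrier (trunc_poly_semiring R m)" "B \<in> carrier (trunc_poly_semiring R m)"
    then obtain p q where AB: "A = trunc_class m p" "B = trunc_class m q" and
      pq: "p \<in> up R" "q \<in> up R"
      by (auto simp: trunc_carrier)
    have "const_term (A \<otimes>\<^bsub>trunc_poly_semiring R m\<^esub> B) = (p \<otimes>\<^bsub>UP R\<^esub> q) 0"
      using pq m by (simp add: AB trunc_mult const_term_trunc_class UP_mult_closed)
    then show "const_term (A \<otimes>\<^bsub>trunc_poly_semiring R m\<^esub> B) = const_term A \<otimes> const_term B"
      using pq m by (simp add: AB const_term_trunc_class UP_mult mem_upD)
    have "const_term (A \<oplus>\<^bsub>trunc_poly_semiring R m\<^esub> B) = (p \<oplus>\<^bsub>UP R\<^esub> q) 0"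
      using pq m by (simp add: AB trunc_add const_term_trunc_class UP_add_closed)
    then show "const_term (A \<oplus>\<^bsub>trunc_poly_semiring R m\<^esub> B) = const_term A \<oplus> const_term B"
      using pq m by (simp add: AB const_term_trunc_class UP_add)
  next
    show "const_term \<one>\<^bsub>trunc_poly_semiring R m\<^esub> = \<one>"
      using m by (simp add: trunc_one const_term_trunc_class UP_one_closed) (simp add: UP_one)
  qed (use m in \<open>auto simp: trunc_carrier const_term_trunc_class mem_upD\<close>)
  show "const_term ` carrier (trunc_poly_semiring R m) = carrier R"
  proof (intro equalityI subsetI)
    fix a
    assume a: "a \<in> carrier R"
    then have "a = const_term (trunc_class m (\<lambda>i. if i = 0 then a else \<zero>))"
      using m by (simp add: const_term_trunc_class up_monom)
    then show "a \<in> const_term ` carrier (trunc_poly_semiring R m)"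
      using a up_monom[of a 0] by (auto simp: trunc_carrier)
  qed (use m in \<open>auto simp: trunc_carrier const_term_trunc_class mem_upD\<close>)
qed (auto simp: trunc_carrier trunc_add trunc_mult trunc_one UP_add_closed UP_mult_closed UP_one_closed)


section \<open>Nilpotent truncated polynomials\<close>

lemma semiring_ideal_cgenideal:
  assumes a: "a \<in> carrier R"
  shows "semiring_ideal R (PIdl a)"
proof -
  have "PIdl a \<noteq> {}"
    by (auto simp: cgenideal_def)
  moreover have "x \<otimes> a \<oplus> y \<otimes> a \<in> PIdl a" if "x \<in> carrier R" "y \<in> carrier R" for x y
    using that a by (auto simp: cgenideal_def simp flip: l_distr intro!: exI[of _ "x \<oplus> y"])
  moreover have "r \<otimes> (x \<otimes> a) \<in> PIdl a" if "r \<in> carrier R" "x \<in> carrier R" for r x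
    using that a by (auto simp: cgenideal_def simp flip: m_assoc intro!: exI[of _ "r \<otimes> x"])
  ultimately show ?thesis
    using a unfolding semiring_ideal_def by (auto simp: cgenideal_def)
qed

lemma semiring_ideal_finsum:
  assumes I: "semiring_ideal R I" and f: "\<And>i. i \<in> A \<Longrightarrow> f i \<in> I"
  shows "finsum R f A \<in> I"
proof -
  obtain a where a: "a \<in> I" "a \<in> carrier R"
    using I by (auto simp: semiring_ideal_def)
  have "\<zero> \<otimes> a \<in> I"
    using I a unfolding semiring_ideal_def by blast
  then have zero: "\<zero> \<in> I"
    using a by simp
  have IR: "I \<subseteq> carrier R"
    using I by (simp add: semiring_ideal_def)
  show ?thesis
    using f
  proof (induction A rule: infinite_finite_induct)
    case (insert i A)
    then have "f \<in> A \<rightarrow> carrier R" "f i \<in> carrier R"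
      using IR by auto
    then show ?case
      using insert I by (simp add: semiring_ideal_def)
  qed (simp_all add: zero)
qed

lemma cgenideal_pow_antimono:
  fixes k l :: nat
  assumes c: "c \<in> carrier R" and le: "k \<le> l"
  shows "PIdl (c [^] l) \<subseteq> PIdl (c [^] k)"
proof
  fix x
  assume "x \<in> PIdl (c [^] l)"
  then obtain y where y: "y \<in> carrier R" "x = y \<otimes> c [^] l"
    by (auto simp: cgenideal_def)
  moreover have "c [^] l = c [^] (l - k) \<otimes> c [^] k"
    using c le by (simp add: nat_pow_mult)
  ultimately have "x = (y \<otimes> c [^] (l - k)) \<otimes> c [^] k"
    using c by (simp add: m_assoc)
  then show "x \<in> PIdl (c [^] k)"
    using c y unfolding cgenideal_def by blast
qed

text \<open>
  Expanding the power of \<open>p\<close>, a term of degree \<open>i\<close> picks a nonconstant coefficient of \<open>p\<close> at most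
  \<open>i\<close> times, and \<open>p 0\<close> at least \<open>n - i\<close> times.  In the induction step, the coefficient \<open>p 0\<close> supplies
  one more factor when \<open>j = i\<close>; when \<open>j < i\<close>, the bound for \<open>q j\<close> already suffices.  For \<open>i \<ge> n\<close> the
  exponent is \<open>0\<close> and the claim is void.
\<close>

lemma trunc_pow_coeffs:
  assumes p: "p \<in> up R"
  shows "\<exists>q\<in>up R. trunc_class m p [^]\<^bsub>trunc_poly_semiring R m\<^esub> (n::nat) = trunc_class m q \<and>
    (\<forall>i. q i \<in> PIdl (p 0 [^] (n - i)))"
proof (induction n)
  case 0
  have "x \<in> PIdl \<one>" if "x \<in> carrier R" for x
    using that by (auto simp: cgenideal_def intro!: exI[of _ x])
  then have "\<one>\<^bsub>UP R\<^esub> i \<in> PIdl (p 0 [^] (0 - i))" for i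
    using UP_one_closed by (simp add: mem_upD)
  moreover have "trunc_class m p [^]\<^bsub>trunc_poly_semiring R m\<^esub> (0::nat) = trunc_class m \<one>\<^bsub>UP R\<^esub>"
    by (simp add: nat_pow_def trunc_one)
  ultimately show ?case
    using UP_one_closed by blast
next
  case (Suc n)
  then obtain q where q: "q \<in> up R"
    and pow: "trunc_class m p [^]\<^bsub>trunc_poly_semiring R m\<^esub> n = trunc_class m q"
    and coeff: "\<And>i. q i \<in> PIdl (p 0 [^] (n - i))"
    by blast
  have p0: "p 0 \<in> carrier R"
    using p by (simp add: mem_upD)
  have "(q \<otimes>\<^bsub>UP R\<^esub> p) i \<in> PIdl (p 0 [^] (Suc n - i))" for i
  proof -
    let ?I = "PIdl (p 0 [^] (Suc n - i))"
    have ideal: "semiring_ideal R ?I"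
      using p0 by (simp add: semiring_ideal_cgenideal)
    have "q j \<otimes> p (i - j) \<in> ?I" if "j \<le> i" for j
    proof (cases "j = i")
      case True
      obtain y where y: "y \<in> carrier R" "q i = y \<otimes> p 0 [^] (n - i)"
        using coeff[of i] by (auto simp: cgenideal_def)
      then have "q i \<otimes> p 0 = y \<otimes> p 0 [^] Suc (n - i)"
        using p0 by (simp add: m_assoc)
      then have "q i \<otimes> p 0 \<in> PIdl (p 0 [^] Suc (n - i))"
        using y unfolding cgenideal_def by blast
      moreover have "PIdl (p 0 [^] Suc (n - i)) \<subseteq> ?I"
        by (rule cgenideal_pow_antimono[OF p0]) arith
      ultimately have "q i \<otimes> p 0 \<in> ?I"
        by blast
      then show ?thesis
        using True by simp
    next
      case False
      then have "Suc n - i \<le> n - j"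
        using that by arith
      then have "q j \<in> ?I"
        using coeff[of j] cgenideal_pow_antimono[OF p0] by blast
      then have "p (i - j) \<otimes> q j \<in> ?I"
        using ideal p by (simp add: semiring_ideal_def mem_upD)
      then show ?thesis
        using p q by (simp add: m_comm mem_upD)
    qed
    then show ?thesis
      unfolding UP_mult[OF q p] by (intro semiring_ideal_finsum[OF ideal]) auto
  qed
  moreover have "trunc_class m p [^]\<^bsub>trunc_poly_semiring R m\<^esub> Suc n = trunc_class m (q \<otimes>\<^bsub>UP R\<^esub> p)"
    using pow p q by (simp add: nat_pow_def trunc_mult)
  ultimately show ?case
    using p q UP_mult_closed by blast
qed

text \<open>
  Homomorphisms preserve nilpotents.  Conversely, if \<open>c^k = 0\<close> for the constant term \<open>c\<close>, then
  in the power \<open>k + m\<close> the coefficient of each \<open>x^i\<close> with \<open>i < m\<close> is a multiple of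
  \<open>c^(k + m - i)\<close>, hence zero.
\<close>

lemma nilradical_trunc_iff:
  assumes m: "m \<ge> 1" and A: "A \<in> carrier (trunc_poly_semiring R m)"
  shows "const_term A \<in> nilradical R \<longleftrightarrow> A \<in> nilradical (trunc_poly_semiring R m)"
proof
  interpret surj_semiring_hom "trunc_poly_semiring R m" R const_term
    by (rule const_term_surj_hom[OF m])
  assume "A \<in> nilradical (trunc_poly_semiring R m)"
  then obtain n where n: "n \<ge> 1" "A [^]\<^bsub>trunc_poly_semiring R m\<^esub> (n::nat) = \<zero>\<^bsub>trunc_poly_semiring R m\<^esub>"
    by (auto simp: nilradical_def)
  have "const_term \<zero>\<^bsub>trunc_poly_semiring R m\<^esub> = \<zero>"
    using m by (simp add: trunc_zero const_term_trunc_class UP_zero_closed) (simp add: UP_zero)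
  then have "const_term A [^] n = \<zero>"
    using hom_pow[OF A, of n] n by simp
  then show "const_term A \<in> nilradical R"
    using n hom_closed[OF A] by (auto simp: nilradical_def)
next
  obtain p where p: "p \<in> up R" "A = trunc_class m p"
    using A by (auto simp: trunc_carrier)
  assume "const_term A \<in> nilradical R"
  then obtain k where k: "k \<ge> 1" "p 0 [^] (k::nat) = \<zero>"
    using p m by (auto simp: nilradical_def const_term_trunc_class)
  obtain q where q: "q \<in> up R"
    "A [^]\<^bsub>trunc_poly_semiring R m\<^esub> (k + m) = trunc_class m q"
    "\<And>i. q i \<in> PIdl (p 0 [^] (k + m - i))"
    using trunc_pow_coeffs[OF p(1)] p(2) by blast
  have "q i = \<zero>" if "i < m" for i
  proof -
    have "q i \<in> PIdl (p 0 [^] k)"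
      using q(3)[of i] cgenideal_pow_antimono[of "p 0" k "k + m - i"] p that
      by (force simp: mem_upD)
    then show ?thesis
      by (auto simp: k cgenideal_def)
  qed
  then have "A [^]\<^bsub>trunc_poly_semiring R m\<^esub> (k + m) = \<zero>\<^bsub>trunc_poly_semiring R m\<^esub>"
    using q by (simp add: trunc_zero trunc_class_eq_iff UP_zero)
  then show "A \<in> nilradical (trunc_poly_semiring R m)"
    using A k(1) by (auto simp: nilradical_def intro!: exI[of _ "k + m"])
qed


section \<open>Constant cosets and the ideal of prescribed constant terms\<close>

lemma const_term_const_cosets:
  assumes m: "m \<ge> 1" and S: "S \<subseteq> carrier R"
  shows "const_cosets R m S \<subseteq> carrier (trunc_poly_semiring R m)"
    and "const_term ` const_cosets R m S = S"
proof -
  have below: "monom (UP R) s 0 \<in> polys_below R m" if "s \<in> S" for s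
    using that S m by (auto simp: polys_below_eq UP_monom up_monom subset_iff)
  have eq: "const_cosets R m S = (\<lambda>s. trunc_class m (monom (UP R) s 0)) ` S"
    using below by (force simp: const_cosets_def coset_eq_trunc_class)
  show "const_cosets R m S \<subseteq> carrier (trunc_poly_semiring R m)"
    using below by (auto simp: eq trunc_carrier polys_below_eq)
  have "const_term (trunc_class m (monom (UP R) s 0)) = s" if "s \<in> S" for s
    using that S m by (simp add: UP_monom up_monom const_term_trunc_class subset_iff)
  then show "const_term ` const_cosets R m S = S"
    by (simp add: eq image_image)
qed

lemma const_term_ideal_eq:
  assumes m: "m \<ge> 1" and I: "I \<subseteq> carrier R"
  shows "const_term_ideal R m I
    = {A \<in> carrier (trunc_poly_semiring R m). const_term A \<in> I}"
proof (intro equalityI subsetI)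
  fix A
  assume "A \<in> const_term_ideal R m I"
  then obtain a where a: "a 0 \<in> I" "\<forall>i\<in>{1..<m}. a i \<in> carrier R"
    and A: "A = poly_below R m a <+\<^bsub>UP R\<^esub> x_power_ideal R m"
    by (auto simp: const_term_ideal_def)
  have a': "a i \<in> carrier R" if "i < m" for i
    using a I that by (cases "i = 0") auto
  let ?p = "poly_below R m a"
  have p: "?p \<in> polys_below R m" "?p \<in> up R"
    using a' by (auto simp: polys_below_def poly_below_closed)
  moreover have "?p 0 \<in> I"
    using a a' m by (simp add: poly_below_eq)
  ultimately show "A \<in> {A \<in> carrier (trunc_poly_semiring R m). const_term A \<in> I}"
    using m by (simp add: A coset_eq_trunc_class trunc_carrier const_term_trunc_class)
next
  fix A
  assume "A \<in> {A \<in> carrier (trunc_poly_semiring R m). const_term A \<in> I}"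
  then obtain p where p: "p \<in> up R" "A = trunc_class m p" "p 0 \<in> I"
    using m by (auto simp: trunc_carrier const_term_trunc_class)
  then show "A \<in> const_term_ideal R m I"
    unfolding const_term_ideal_def
    by (auto simp: coset_poly_below mem_upD intro!: exI[of _ p])
qed

end


section \<open>Quasi n-ideals of the truncated polynomial semiring\<close>

theorem theorem2p26:
  fixes R (structure) and S I' :: "'a set" and m :: nat
  assumes "commutative_semiring R"
    and "mult_closed R S"
    and "proper_semiring_ideal R I'"
    and "I' \<inter> S = {}"
    and "m \<ge> 1"
  shows "semiring_ideal (trunc_poly_semiring R m) (const_term_ideal R m I')
    \<and> const_cosets R m S \<inter> const_term_ideal R m I' = {}
    \<and> (quasi_n_ideal (trunc_poly_semiring R m) (const_cosets R m S) (const_term_ideal R m I')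
         \<longleftrightarrow> quasi_n_ideal R S I')"
proof -
  interpret commutative_semiring R
    by fact
  interpret surj_semiring_hom "trunc_poly_semiring R m" R const_term
    by (rule const_term_surj_hom[OF \<open>m \<ge> 1\<close>])
  have "S \<subseteq> carrier R"
    using \<open>mult_closed R S\<close> by (simp add: mult_closed_def)
  note cosets = const_term_const_cosets[OF \<open>m \<ge> 1\<close> this]
  have ideal: "semiring_ideal R I'"
    using \<open>proper_semiring_ideal R I'\<close> by (simp add: proper_semiring_ideal_def)
  then have J: "const_term_ideal R m I' = preimage I'"
    using const_term_ideal_eq[OF \<open>m \<ge> 1\<close>] by (simp add: preimage_def semiring_ideal_def)
  show ?thesis
    unfolding J
    using preimage_semiring_ideal[OF ideal] preimage_disjoint[OF cosets(2) \<open>I' \<inter> S = {}\<close>]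
      quasi_n_ideal_preimage_iff[OF nilradical_trunc_iff[OF \<open>m \<ge> 1\<close>] cosets
        \<open>proper_semiring_ideal R I'\<close> \<open>I' \<inter> S = {}\<close>]
    by (simp add: Int_commute)
qed

end
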